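(* Let $f\colon P\twoheadrightarrow Q$ be an operator-reduced quandle homomorphism such that $\mathrm{Inn}_{\mathrm{rel}}(f)$ is a finite group. If $Q$ is nilpotent, then both $f$ and $P$ are nilpotent.
   Context: A quandle is a set $Q$ with a map $s_x\colon Q\to Q$ for each $x\in Q$ such that, for all $x,y\in Q$, $s_x(x)=x$, $s_x$ is bijective, and $s_x\circ s_y=s_{s_x(y)}\circ s_x$. A quandle homomorphism is a map $f\colon P\to Q$ with $f\circ s_x=s_{f(x)}\circ f$ for all $x\in P$. The inner automorphism group $\mathrm{Inn}(Q)$ is the subgroup of $\mathrm{Aut}(Q)$ generated by all $s_x$. A quandle $Q$ is nilpotent if the group $\mathrm{Inn}(Q)$ is nilpotent. For a surjective quandle homomorphism $f\colon P\twoheadrightarrow Q$ there is a unique surjective group homomorphism $f_*\colon\mathrm{Inn}(P)\to\mathrm{Inn}(Q)$ with $f_*(s_x)=s_{f(x)}$; put $\mathrm{Inn}_{\mathrm{rel}}(f)=\mathrm{Ker}(f_* )$. For subgroups $A,B$ of a group, $[A,B]$ is the subgroup generated by all $[a,b]=aba^{-1}b^{-1}$. For $N\trianglelefteq G$ put $\Gamma_0(G,N)=N$, $\Gamma_{i+1}(G,N)=[G,\Gamma_i(G,N)]$. The surjective homomorphism $f$ is nilpotent if $\Gamma_c(\mathrm{Inn}(P),\mathrm{Inn}_{\mathrm{rel}}(f))=1$ for some integer $c\ge0$. A surjective quandle homomorphism $f$ is operator-reduced if $s_xs_{\varphi(x)}=s_{\varphi(x)}s_x$ for every $x\in P$ and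 every $\varphi\in\mathrm{Inn}_{\mathrm{rel}}(f)$. *)

theory Defs
  imports "HOL-Algebra.Algebra"
begin

section \<open>Quandles\<close>

record 'a quandle = "'a partial_object" +
  act :: "'a \<Rightarrow> 'a \<Rightarrow> 'a"

text \<open>\<open>act Q x y\<close> is $s_x(y)$. The empty quandle is allowed.\<close>

locale quandle =
  fixes Q :: "('a, 'm) quandle_scheme" (structure)
  assumes act_bij: "x \<in> carrier Q \<Longrightarrow> bij_betw (act Q x) (carrier Q) (carrier Q)"
    and act_idem: "x \<in> carrier Q \<Longrightarrow> act Q x x = x"
    and act_distrib: "\<lbrakk>x \<in> carrier Q; y \<in> carrier Q; z \<in> carrier Q\<rbrakk>
      \<Longrightarrow> act Q x (act Q y z) = act Q (act Q x y) (act Q x z)"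

definition quandle_hom ::
    "('a, 'm) quandle_scheme \<Rightarrow> ('b, 'n) quandle_scheme \<Rightarrow> ('a \<Rightarrow> 'b) set" where
  "quandle_hom P Q = {f \<in> carrier P \<rightarrow> carrier Q.
     \<forall>x\<in>carrier P. \<forall>y\<in>carrier P. f (act P x y) = act Q (f x) (f y)}"

definition quandle_epi ::
    "('a, 'm) quandle_scheme \<Rightarrow> ('b, 'n) quandle_scheme \<Rightarrow> ('a \<Rightarrow> 'b) set" where
  "quandle_epi P Q = {f \<in> quandle_hom P Q. f ` carrier P = carrier Q}"

text \<open>$s_x$ as an extensional function, i.e. as an element of \<open>BijGroup (carrier Q)\<close>.\<close>

definition symm :: "('a, 'm) quandle_scheme \<Rightarrow> 'a \<Rightarrow> 'a \<Rightarrow> 'a" where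
  "symm Q x = (\<lambda>y\<in>carrier Q. act Q x y)"

definition Aut :: "('a, 'm) quandle_scheme \<Rightarrow> ('a \<Rightarrow> 'a) monoid" where
  "Aut Q = BijGroup (carrier Q) \<lparr>carrier := quandle_hom Q Q \<inter> Bij (carrier Q)\<rparr>"

definition Inn :: "('a, 'm) quandle_scheme \<Rightarrow> ('a \<Rightarrow> 'a) monoid" where
  "Inn Q = (Aut Q) \<lparr>carrier := generate (Aut Q) (symm Q ` carrier Q)\<rparr>"


section \<open>Nilpotency\<close>

definition commutator_subgroup ::
    "('a, 'm) monoid_scheme \<Rightarrow> 'a set \<Rightarrow> 'a set \<Rightarrow> 'a set" where
  "commutator_subgroup G A B =
     generate G {a \<otimes>\<^bsub>G\<^esub> b \<otimes>\<^bsub>G\<^esub> inv\<^bsub>G\<^esub> a \<otimes>\<^bsub>G\<^esub> inv\<^bsub>G\<^esub> b | a b. a \<in> A \<and> b \<in> B}"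

primrec Gamma :: "('a, 'm) monoid_scheme \<Rightarrow> 'a set \<Rightarrow> nat \<Rightarrow> 'a set" where
  "Gamma G N 0 = N"
| "Gamma G N (Suc i) = commutator_subgroup G (carrier G) (Gamma G N i)"

text \<open>\<open>Gamma G (carrier G)\<close> is the lower central series of \<open>G\<close>.\<close>

definition nilpotent_group :: "('a, 'm) monoid_scheme \<Rightarrow> bool" where
  "nilpotent_group G \<longleftrightarrow> group G \<and> (\<exists>c. Gamma G (carrier G) c = {\<one>\<^bsub>G\<^esub>})"

definition nilpotent_quandle :: "('a, 'm) quandle_scheme \<Rightarrow> bool" where
  "nilpotent_quandle Q \<longleftrightarrow> nilpotent_group (Inn Q)"


section \<open>The induced homomorphism of inner automorphism groups\<close>

text \<open>
  The description determines $f_*$ for a surjective quandle homomorphism; see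
  \<open>induced_unique\<close> at the end of this theory. Extensionality fixes the values outside
  \<open>carrier (Inn P)\<close>.
\<close>

definition induced ::
    "('a, 'm) quandle_scheme \<Rightarrow> ('b, 'n) quandle_scheme \<Rightarrow> ('a \<Rightarrow> 'b)
      \<Rightarrow> ('a \<Rightarrow> 'a) \<Rightarrow> ('b \<Rightarrow> 'b)" where
  "induced P Q f = (THE h. h \<in> epi (Inn P) (Inn Q) \<and> h \<in> extensional (carrier (Inn P)) \<and>
     (\<forall>x\<in>carrier P. h (symm P x) = symm Q (f x)))"

definition Inn_rel ::
    "('a, 'm) quandle_scheme \<Rightarrow> ('b, 'n) quandle_scheme \<Rightarrow> ('a \<Rightarrow> 'b) \<Rightarrow> ('a \<Rightarrow> 'a) set" where
  "Inn_rel P Q f = kernel (Inn P) (Inn Q) (induced P Q f)"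

definition nilpotent_hom ::
    "('a, 'm) quandle_scheme \<Rightarrow> ('b, 'n) quandle_scheme \<Rightarrow> ('a \<Rightarrow> 'b) \<Rightarrow> bool" where
  "nilpotent_hom P Q f \<longleftrightarrow> f \<in> quandle_epi P Q \<and>
     (\<exists>c. Gamma (Inn P) (Inn_rel P Q f) c = {\<one>\<^bsub>Inn P\<^esub>})"

definition operator_reduced ::
    "('a, 'm) quandle_scheme \<Rightarrow> ('b, 'n) quandle_scheme \<Rightarrow> ('a \<Rightarrow> 'b) \<Rightarrow> bool" where
  "operator_reduced P Q f \<longleftrightarrow> f \<in> quandle_epi P Q \<and>
     (\<forall>x\<in>carrier P. \<forall>\<phi>\<in>Inn_rel P Q f.
        symm P x \<otimes>\<^bsub>Inn P\<^esub> symm P (\<phi> x) = symm P (\<phi> x) \<otimes>\<^bsub>Inn P\<^esub> symm P x)"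


section \<open>Well-definedness\<close>

lemma (in quandle) act_closed: "\<lbrakk>x \<in> carrier Q; y \<in> carrier Q\<rbrakk> \<Longrightarrow> act Q x y \<in> carrier Q"
  using act_bij bij_betwE by blast

lemma (in quandle) subgroup_Aut:
  "subgroup (quandle_hom Q Q \<inter> Bij (carrier Q)) (BijGroup (carrier Q))"
proof (rule subgroup.intro)
  show "quandle_hom Q Q \<inter> Bij (carrier Q) \<subseteq> carrier (BijGroup (carrier Q))"
    by (auto simp: BijGroup_def)
next
  fix g h assume "g \<in> quandle_hom Q Q \<inter> Bij (carrier Q)" "h \<in> quandle_hom Q Q \<inter> Bij (carrier Q)"
  then show "g \<otimes>\<^bsub>BijGroup (carrier Q)\<^esub> h \<in> quandle_hom Q Q \<inter> Bij (carrier Q)"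
    by (auto simp: BijGroup_def compose_Bij quandle_hom_def compose_eq act_closed Pi_iff)
next
  show "\<one>\<^bsub>BijGroup (carrier Q)\<^esub> \<in> quandle_hom Q Q \<inter> Bij (carrier Q)"
    by (auto simp: BijGroup_def id_Bij quandle_hom_def act_closed)
next
  fix g assume g: "g \<in> quandle_hom Q Q \<inter> Bij (carrier Q)"
  then have hom: "\<And>x y. \<lbrakk>x \<in> carrier Q; y \<in> carrier Q\<rbrakk> \<Longrightarrow> g (act Q x y) = act Q (g x) (g y)"
    by (auto simp: quandle_hom_def)
  have act: "act Q \<in> carrier Q \<rightarrow> carrier Q \<rightarrow> carrier Q"
    by (auto simp: act_closed)
  have "restrict (inv_into (carrier Q) g) (carrier Q) \<in> quandle_hom Q Q"
    using g Bij_inv_into_lemma[OF hom _ act]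
    by (auto simp: quandle_hom_def act_closed Bij_inv_into_mem)
  then show "inv\<^bsub>BijGroup (carrier Q)\<^esub> g \<in> quandle_hom Q Q \<inter> Bij (carrier Q)"
    using g by (simp add: inv_BijGroup restrict_inv_into_Bij)
qed

lemma (in quandle) group_Aut: "group (Aut Q)"
  unfolding Aut_def by (rule subgroup.subgroup_is_group[OF subgroup_Aut group_BijGroup])

lemma (in quandle) symm_in_Aut:
  assumes "x \<in> carrier Q"
  shows "symm Q x \<in> carrier (Aut Q)"
proof -
  have "bij_betw (symm Q x) (carrier Q) (carrier Q)"
    using act_bij[OF assms] by (simp add: symm_def cong: bij_betw_cong)
  then show ?thesis
    using assms
    by (auto simp: Aut_def quandle_hom_def Bij_def symm_def act_closed intro: act_distrib)
qed

lemma (in quandle) subgroup_Inn: "subgroup (carrier (Inn Q)) (Aut Q)"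
  using group.generate_is_subgroup[OF group_Aut image_subsetI[OF symm_in_Aut]]
  by (simp add: Inn_def)

lemma (in quandle) group_Inn: "group (Inn Q)"
  using subgroup.subgroup_is_group[OF subgroup_Inn group_Aut] by (simp add: Inn_def)

lemma (in quandle) symm_in_Inn: "x \<in> carrier Q \<Longrightarrow> symm Q x \<in> carrier (Inn Q)"
  by (auto simp: Inn_def intro: generate.incl)

lemma (in quandle) Inn_in_Bij: "g \<in> carrier (Inn Q) \<Longrightarrow> g \<in> Bij (carrier Q)"
  using subgroup.subset[OF subgroup_Inn] by (auto simp: Aut_def)

lemma (in quandle) Inn_mult:
  assumes "g \<in> carrier (Inn Q)" "h \<in> carrier (Inn Q)"
  shows "g \<otimes>\<^bsub>Inn Q\<^esub> h = compose (carrier Q) g h"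
proof -
  have "g \<otimes>\<^bsub>Inn Q\<^esub> h = g \<otimes>\<^bsub>BijGroup (carrier Q)\<^esub> h" by (simp add: Inn_def Aut_def)
  also have "\<dots> = compose (carrier Q) g h"
    using Inn_in_Bij[OF assms(1)] Inn_in_Bij[OF assms(2)] by (simp add: BijGroup_def)
  finally show ?thesis .
qed

lemma Inn_one: "\<one>\<^bsub>Inn Q\<^esub> = (\<lambda>x\<in>carrier Q. x)"
  by (simp add: Inn_def Aut_def BijGroup_def)

lemma (in quandle) Inn_inv:
  assumes "g \<in> carrier (Inn Q)"
  shows "inv\<^bsub>Aut Q\<^esub> g = inv\<^bsub>Inn Q\<^esub> g"
proof -
  have "(Aut Q)\<lparr>carrier := carrier (Inn Q)\<rparr> = Inn Q" by (simp add: Inn_def)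
  then show ?thesis using group.m_inv_consistent[OF group_Aut subgroup_Inn assms] by metis
qed

lemma (in quandle) Inn_inv_apply:
  assumes g: "g \<in> carrier (Inn Q)" and x: "x \<in> carrier Q"
  shows "g ((inv\<^bsub>Inn Q\<^esub> g) x) = x" "(inv\<^bsub>Inn Q\<^esub> g) x \<in> carrier Q"
proof -
  have i: "inv\<^bsub>Inn Q\<^esub> g \<in> carrier (Inn Q)" by (rule group.inv_closed[OF group_Inn g])
  have "compose (carrier Q) g (inv\<^bsub>Inn Q\<^esub> g) = g \<otimes>\<^bsub>Inn Q\<^esub> inv\<^bsub>Inn Q\<^esub> g"
    by (rule Inn_mult[OF g i, symmetric])
  also have "\<dots> = \<one>\<^bsub>Inn Q\<^esub>" by (rule group.r_inv[OF group_Inn g])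
  also have "\<dots> = (\<lambda>x\<in>carrier Q. x)" by (rule Inn_one)
  finally show "g ((inv\<^bsub>Inn Q\<^esub> g) x) = x" using x by (metis compose_eq restrict_apply')
  show "(inv\<^bsub>Inn Q\<^esub> g) x \<in> carrier Q" using Bij_imp_funcset[OF Inn_in_Bij[OF i]] x by blast
qed

text \<open>Two homomorphisms on \<open>Inn P\<close> that agree on the generators $s_x$ are equal.\<close>

lemma induced_ext:
  assumes P: "quandle P" and K: "group K"
    and h: "h \<in> hom (Inn P) K" and k: "k \<in> hom (Inn P) K"
    and eq: "\<And>x. x \<in> carrier P \<Longrightarrow> h (symm P x) = k (symm P x)"
    and g: "g \<in> carrier (Inn P)"
  shows "h g = k g"
proof -
  interpret P: quandle P by fact
  interpret h: group_hom "Inn P" K h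
    using h K P.group_Inn by (simp add: group_hom_def group_hom_axioms_def)
  interpret k: group_hom "Inn P" K k
    using k K P.group_Inn by (simp add: group_hom_def group_hom_axioms_def)
  have gen: "g \<in> generate (Aut P) (symm P ` carrier P)" using g by (simp add: Inn_def)
  have car: "carrier (Inn P) = generate (Aut P) (symm P ` carrier P)" by (simp add: Inn_def)
  from gen show ?thesis
  proof induction
    case one
    have "\<one>\<^bsub>Aut P\<^esub> = \<one>\<^bsub>Inn P\<^esub>" by (simp add: Inn_def)
    then show ?case by simp
  next
    case (incl a)
    then show ?case using eq by auto
  next
    case (inv a)
    then have "a \<in> carrier (Inn P)" using P.symm_in_Inn by auto
    with inv show ?case using eq by (auto simp: P.Inn_inv)
  next
    case (eng a b)
    have "a \<otimes>\<^bsub>Aut P\<^esub> b = a \<otimes>\<^bsub>Inn P\<^esub> b" by (simp add: Inn_def)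
    with eng show ?case by (simp add: car[symmetric])
  qed
qed

lemma Inn_lift:
  assumes P: "quandle P" and Q: "quandle Q" and f: "f \<in> quandle_epi P Q"
    and g: "g \<in> carrier (Inn P)"
  shows "\<exists>v\<in>carrier (Inn Q). \<forall>x\<in>carrier P. v (f x) = f (g x)"
proof -
  interpret P: quandle P by fact
  interpret Q: quandle Q by fact
  interpret IP: group "Inn P" by (rule P.group_Inn)
  interpret IQ: group "Inn Q" by (rule Q.group_Inn)
  have fQ: "\<And>x. x \<in> carrier P \<Longrightarrow> f x \<in> carrier Q"
    and fact: "\<And>x y. \<lbrakk>x \<in> carrier P; y \<in> carrier P\<rbrakk> \<Longrightarrow> f (act P x y) = act Q (f x) (f y)"
    using f by (auto simp: quandle_epi_def quandle_hom_def)
  have car: "carrier (Inn P) = generate (Aut P) (symm P ` carrier P)" by (simp add: Inn_def)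
  have gen: "\<exists>v\<in>carrier (Inn Q). \<forall>y\<in>carrier P. v (f y) = f (symm P x y)"
    if x: "x \<in> carrier P" for x
    using Q.symm_in_Inn[OF fQ[OF x]]
    by (intro bexI[of _ "symm Q (f x)"]) (simp_all add: symm_def fact fQ x)
  have "g \<in> generate (Aut P) (symm P ` carrier P)" using g by (simp add: Inn_def)
  then show ?thesis
  proof induction
    case one
    have "\<one>\<^bsub>Aut P\<^esub> = (\<lambda>x\<in>carrier P. x)" by (simp add: Aut_def BijGroup_def)
    then show ?case by (intro bexI[OF _ IQ.one_closed]) (auto simp: Inn_one fQ)
  next
    case (incl a)
    then obtain x where "x \<in> carrier P" "a = symm P x" by blast
    then show ?case using gen by simp
  next
    case (inv a)
    then have a: "a \<in> carrier (Inn P)" using P.symm_in_Inn by auto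
    from inv obtain x where x: "x \<in> carrier P" "a = symm P x" by blast
    obtain v where v: "v \<in> carrier (Inn Q)" "\<And>y. y \<in> carrier P \<Longrightarrow> v (f y) = f (a y)"
      using gen[OF x(1)] x(2) by auto
    have inj: "inj_on v (carrier Q)" using Q.Inn_in_Bij[OF v(1)] by (auto simp: Bij_def bij_betw_def)
    have "(inv\<^bsub>Inn Q\<^esub> v) (f y) = f ((inv\<^bsub>Inn P\<^esub> a) y)" if y: "y \<in> carrier P" for y
    proof (rule inj_onD[OF inj])
      show "v ((inv\<^bsub>Inn Q\<^esub> v) (f y)) = v (f ((inv\<^bsub>Inn P\<^esub> a) y))"
        using P.Inn_inv_apply[OF a y] Q.Inn_inv_apply[OF v(1) fQ[OF y]] v(2) by simp
    qed (use P.Inn_inv_apply[OF a y] Q.Inn_inv_apply[OF v(1) fQ[OF y]] fQ in auto)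
    then show ?case using v(1) by (intro bexI[of _ "inv\<^bsub>Inn Q\<^esub> v"]) (auto simp: P.Inn_inv[OF a])
  next
    case (eng a b)
    then have a: "a \<in> carrier (Inn P)" and b: "b \<in> carrier (Inn P)" by (auto simp: car)
    obtain v w where v: "v \<in> carrier (Inn Q)" "\<And>y. y \<in> carrier P \<Longrightarrow> v (f y) = f (a y)"
      and w: "w \<in> carrier (Inn Q)" "\<And>y. y \<in> carrier P \<Longrightarrow> w (f y) = f (b y)"
      using eng.IH by auto
    have ab: "a \<otimes>\<^bsub>Aut P\<^esub> b = a \<otimes>\<^bsub>Inn P\<^esub> b" by (simp add: Inn_def)
    have bc: "\<And>y. y \<in> carrier P \<Longrightarrow> b y \<in> carrier P"
      using Bij_imp_funcset[OF P.Inn_in_Bij[OF b]] by auto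
    show ?case
      unfolding ab using v w a b bc fQ
      by (intro bexI[OF _ IQ.m_closed[OF v(1) w(1)]]) (auto simp: P.Inn_mult Q.Inn_mult compose_eq)
  qed
qed

theorem induced_unique:
  assumes P: "quandle P" and Q: "quandle Q" and f: "f \<in> quandle_epi P Q"
  shows "\<exists>!h. h \<in> epi (Inn P) (Inn Q) \<and> h \<in> extensional (carrier (Inn P)) \<and>
     (\<forall>x\<in>carrier P. h (symm P x) = symm Q (f x))"
proof (rule ex_ex1I)
  interpret P: quandle P by fact
  interpret Q: quandle Q by fact
  interpret IP: group "Inn P" by (rule P.group_Inn)
  interpret IQ: group "Inn Q" by (rule Q.group_Inn)
  have fQ: "\<And>x. x \<in> carrier P \<Longrightarrow> f x \<in> carrier Q"
    and fact: "\<And>x y. \<lbrakk>x \<in> carrier P; y \<in> carrier P\<rbrakk> \<Longrightarrow> f (act P x y) = act Q (f x) (f y)"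
    and surj: "f ` carrier P = carrier Q"
    using f by (auto simp: quandle_epi_def quandle_hom_def)
  have "\<forall>g\<in>carrier (Inn P). \<exists>v. v \<in> carrier (Inn Q) \<and> (\<forall>x\<in>carrier P. v (f x) = f (g x))"
    using Inn_lift[OF P Q f] by blast
  then obtain F where "\<forall>g\<in>carrier (Inn P). F g \<in> carrier (Inn Q) \<and> (\<forall>x\<in>carrier P. F g (f x) = f (g x))"
    by (rule bchoice[THEN exE])
  then have F: "\<And>g. g \<in> carrier (Inn P) \<Longrightarrow> F g \<in> carrier (Inn Q)"
    "\<And>g x. \<lbrakk>g \<in> carrier (Inn P); x \<in> carrier P\<rbrakk> \<Longrightarrow> F g (f x) = f (g x)"
    by blast+
  define h where "h = restrict F (carrier (Inn P))"
  have F_eq: "F g = v" if g: "g \<in> carrier (Inn P)" and v: "v \<in> carrier (Inn Q)"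
    and eq: "\<And>x. x \<in> carrier P \<Longrightarrow> v (f x) = f (g x)" for g v
  proof (rule extensionalityI[of _ "carrier Q"])
    show "F g \<in> extensional (carrier Q)" "v \<in> extensional (carrier Q)"
      by (rule Bij_imp_extensional[OF Q.Inn_in_Bij[OF F(1)[OF g]]],
        rule Bij_imp_extensional[OF Q.Inn_in_Bij[OF v]])
    fix q assume "q \<in> carrier Q"
    then obtain x where "x \<in> carrier P" "q = f x" using surj by blast
    then show "F g q = v q" using F(2)[OF g] eq by simp
  qed
  have gens: "h (symm P x) = symm Q (f x)" if x: "x \<in> carrier P" for x
  proof -
    have "F (symm P x) = symm Q (f x)"
      by (rule F_eq[OF P.symm_in_Inn[OF x] Q.symm_in_Inn[OF fQ[OF x]]])
        (simp add: symm_def fact fQ x)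
    then show ?thesis using P.symm_in_Inn[OF x] by (simp add: h_def)
  qed
  have hom: "h \<in> hom (Inn P) (Inn Q)"
  proof (rule homI)
    fix a b assume a: "a \<in> carrier (Inn P)" and b: "b \<in> carrier (Inn P)"
    show "h a \<in> carrier (Inn Q)" using F a by (simp add: h_def)
    have bc: "\<And>y. y \<in> carrier P \<Longrightarrow> b y \<in> carrier P"
      using Bij_imp_funcset[OF P.Inn_in_Bij[OF b]] by auto
    have "F (a \<otimes>\<^bsub>Inn P\<^esub> b) = F a \<otimes>\<^bsub>Inn Q\<^esub> F b"
    proof (rule F_eq)
      fix x assume x: "x \<in> carrier P"
      show "(F a \<otimes>\<^bsub>Inn Q\<^esub> F b) (f x) = f ((a \<otimes>\<^bsub>Inn P\<^esub> b) x)"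
        using F a b bc fQ x by (simp add: P.Inn_mult Q.Inn_mult compose_eq)
    qed (use F(1) a b in simp_all)
    then show "h (a \<otimes>\<^bsub>Inn P\<^esub> b) = h a \<otimes>\<^bsub>Inn Q\<^esub> h b" using a b by (simp add: h_def)
  qed
  interpret h: group_hom "Inn P" "Inn Q" h
    using hom by (simp add: group_hom_def group_hom_axioms_def IP.is_group IQ.is_group)
  have "v \<in> h ` carrier (Inn P)" if "v \<in> carrier (Inn Q)" for v
  proof -
    have "v \<in> generate (Aut Q) (symm Q ` carrier Q)" using that by (simp add: Inn_def)
    then show ?thesis
    proof induction
      case one
      have "\<one>\<^bsub>Aut Q\<^esub> = \<one>\<^bsub>Inn Q\<^esub>" by (simp add: Inn_def)
      then have "\<one>\<^bsub>Aut Q\<^esub> = h \<one>\<^bsub>Inn P\<^esub>" by (metis h.hom_one)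
      then show ?case using IP.one_closed by (metis imageI)
    next
      case (incl a)
      then have "a \<in> symm Q ` f ` carrier P" by (simp add: surj)
      then obtain x where x: "x \<in> carrier P" "a = symm Q (f x)" by auto
      then have "a = h (symm P x)" by (simp add: gens)
      then show ?case using P.symm_in_Inn[OF x(1)] by simp
    next
      case (inv a)
      then have "a \<in> symm Q ` f ` carrier P" by (simp add: surj)
      then obtain x where x: "x \<in> carrier P" "a = symm Q (f x)" by auto
      then have "inv\<^bsub>Aut Q\<^esub> a = h (inv\<^bsub>Inn P\<^esub> (symm P x))"
        using gens P.symm_in_Inn Q.symm_in_Inn fQ by (simp add: Q.Inn_inv)
      moreover have "inv\<^bsub>Inn P\<^esub> (symm P x) \<in> carrier (Inn P)"
        using P.symm_in_Inn[OF x(1)] by simp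
      ultimately show ?case by (metis imageI)
    next
      case (eng a b)
      have "a \<otimes>\<^bsub>Aut Q\<^esub> b = a \<otimes>\<^bsub>Inn Q\<^esub> b" by (simp add: Inn_def)
      moreover obtain c d where cd: "c \<in> carrier (Inn P)" "d \<in> carrier (Inn P)" "a = h c" "b = h d"
        using eng.IH by auto
      moreover have "h (c \<otimes>\<^bsub>Inn P\<^esub> d) \<in> h ` carrier (Inn P)" using cd by (intro imageI) simp
      ultimately show ?case by simp
    qed
  qed
  then have "carrier (Inn Q) \<subseteq> h ` carrier (Inn P)" by blast
  then have "h ` carrier (Inn P) = carrier (Inn Q)" using h.hom_closed by blast
  then have "h \<in> epi (Inn P) (Inn Q)" using hom by (simp add: epi_def)
  then show "\<exists>h. h \<in> epi (Inn P) (Inn Q) \<and> h \<in> extensional (carrier (Inn P)) \<and>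
     (\<forall>x\<in>carrier P. h (symm P x) = symm Q (f x))"
    using gens by (intro exI[of _ h] conjI) (simp_all add: h_def)
next
  fix h k
  assume h: "h \<in> epi (Inn P) (Inn Q) \<and> h \<in> extensional (carrier (Inn P)) \<and>
     (\<forall>x\<in>carrier P. h (symm P x) = symm Q (f x))"
    and k: "k \<in> epi (Inn P) (Inn Q) \<and> k \<in> extensional (carrier (Inn P)) \<and>
     (\<forall>x\<in>carrier P. k (symm P x) = symm Q (f x))"
  show "h = k"
  proof (rule extensionalityI)
    show "h \<in> extensional (carrier (Inn P))" "k \<in> extensional (carrier (Inn P))"
      using h k by blast+
    have hh: "h \<in> hom (Inn P) (Inn Q)" and kk: "k \<in> hom (Inn P) (Inn Q)"
      using h k by (simp_all add: epi_def)
    have "h (symm P x) = k (symm P x)" if "x \<in> carrier P" for x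
      using h k that by metis
    then show "h g = k g" if "g \<in> carrier (Inn P)" for g
      using induced_ext[OF P quandle.group_Inn[OF Q] hh kk _ that] by blast
  qed
qed

end

theory Submission
  imports Defs
begin

text \<open>
  Put $G = \mathrm{Inn}(P)$ and $K = \mathrm{Inn}_{\mathrm{rel}}(f)$. Since
  $\varphi s_x \varphi^{-1} = s_{\varphi(x)}$, the group $G$ is generated by a conjugation-invariant set
  whose elements commute with their $K$-conjugates. By induction on the order of $K$ it suffices to
  show that a chief factor $K/N$ is central in $G/N$, so let $K$ be minimal normal in $G$. If a
  generator $g$ does not centralize $K$, then its $K$-conjugates generate an abelian group which meets
  $K$ in a nontrivial abelian normal subgroup of $K$; by minimality $K$ is abelian. Then the nilpotent
  group $G/K$ acts on $K$. If this action is nontrivial, some generator or some commutator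
  $z = [g,w]$ with $g$ a generator acts as a nontrivial central element. In the second case
  $z = g \cdot (w g w^{-1})^{-1}$ is a product of two commuting unipotents. Hence $z$ has a
  nontrivial fixed point, and the fixed points of $z$ form a normal subgroup of $G$, so $z$ acts
  trivially, a contradiction.
\<close>

section \<open>Centralizers and lower central series\<close>

definition centralizer :: "('a, 'm) monoid_scheme \<Rightarrow> 'a set \<Rightarrow> 'a set" where
  "centralizer G T = {v \<in> carrier G. \<forall>x\<in>T. v \<otimes>\<^bsub>G\<^esub> x = x \<otimes>\<^bsub>G\<^esub> v}"

context group
begin

section \<open>Conjugation and commutation in a group\<close>

lemma mult_inv_cancel:
  assumes "x \<in> carrier G" "y \<in> carrier G"
  shows "inv x \<otimes> (x \<otimes> y) = y" "x \<otimes> (inv x \<otimes> y) = y"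
  using assms by (simp_all flip: m_assoc)

lemma conj_mult:
  assumes "h \<in> carrier G" "x \<in> carrier G" "y \<in> carrier G"
  shows "(h \<otimes> x \<otimes> inv h) \<otimes> (h \<otimes> y \<otimes> inv h) = h \<otimes> (x \<otimes> y) \<otimes> inv h"
  using assms by (simp add: m_assoc mult_inv_cancel)

lemma conj_inv_cancel:
  assumes "h \<in> carrier G" "x \<in> carrier G"
  shows "h \<otimes> (inv h \<otimes> x \<otimes> h) \<otimes> inv h = x" "inv h \<otimes> (h \<otimes> x \<otimes> inv h) \<otimes> h = x"
  using assms by (simp_all add: m_assoc mult_inv_cancel)

lemma conj_compose:
  assumes "g \<in> carrier G" "h \<in> carrier G" "x \<in> carrier G"
  shows "g \<otimes> (h \<otimes> x \<otimes> inv h) \<otimes> inv g = (g \<otimes> h) \<otimes> x \<otimes> inv (g \<otimes> h)"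
  using assms by (simp add: m_assoc inv_mult_group)

lemma commute_iff_conj:
  assumes "x \<in> carrier G" "y \<in> carrier G"
  shows "x \<otimes> y = y \<otimes> x \<longleftrightarrow> x \<otimes> y \<otimes> inv x = y"
  using assms by (metis inv_solve_right m_closed)

lemma commute_iff_commutator:
  assumes "x \<in> carrier G" "y \<in> carrier G"
  shows "x \<otimes> y = y \<otimes> x \<longleftrightarrow> x \<otimes> y \<otimes> inv x \<otimes> inv y = \<one>"
  using assms by (metis commute_iff_conj inv_closed inv_inv inv_equality l_inv m_closed r_inv)

section \<open>Centralizers\<close>

lemma subgroup_centralizer:
  assumes "T \<subseteq> carrier G"
  shows "subgroup (centralizer G T) G"
proof (rule subgroupI)
  show "centralizer G T \<subseteq> carrier G" by (auto simp: centralizer_def)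
  show "centralizer G T \<noteq> {}" using assms by (auto simp: centralizer_def intro!: exI[of _ \<one>])
next
  fix v assume v: "v \<in> centralizer G T"
  have "inv v \<otimes> x = x \<otimes> inv v" if "x \<in> T" for x
  proof -
    have x: "x \<in> carrier G" "v \<in> carrier G" "v \<otimes> x = x \<otimes> v"
      using v that assms by (auto simp: centralizer_def)
    then have "inv v \<otimes> (x \<otimes> v) \<otimes> inv v = inv v \<otimes> (v \<otimes> x) \<otimes> inv v" by simp
    with x(1,2) show ?thesis by (simp add: m_assoc mult_inv_cancel)
  qed
  then show "inv v \<in> centralizer G T" using v by (auto simp: centralizer_def)
next
  fix v w assume v: "v \<in> centralizer G T" and w: "w \<in> centralizer G T"
  have "v \<otimes> w \<otimes> x = x \<otimes> (v \<otimes> w)" if "x \<in> T" for x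
  proof -
    have c: "x \<in> carrier G" "v \<in> carrier G" "w \<in> carrier G" "v \<otimes> x = x \<otimes> v" "w \<otimes> x = x \<otimes> w"
      using v w that assms by (auto simp: centralizer_def)
    from c(1-3,5) have "v \<otimes> w \<otimes> x = v \<otimes> x \<otimes> w" by (simp add: m_assoc)
    also have "\<dots> = x \<otimes> (v \<otimes> w)" using c(1-4) by (simp flip: m_assoc)
    finally show ?thesis .
  qed
  then show "v \<otimes> w \<in> centralizer G T" using v w by (auto simp: centralizer_def)
qed

text \<open>The element h^-1 x h lies in \<open>T\<close>, so it commutes with \<open>v\<close>;
  conjugate back by \<open>h\<close>. Invariance is asked for a single \<open>h\<close> because some
  sets \<open>T\<close> below are only known to be stable under \<open>K\<close>.\<close>

lemma centralizer_conj:
  assumes T: "T \<subseteq> carrier G" and h: "h \<in> carrier G"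
    and inva: "\<And>x. x \<in> T \<Longrightarrow> inv h \<otimes> x \<otimes> h \<in> T" and v: "v \<in> centralizer G T"
  shows "h \<otimes> v \<otimes> inv h \<in> centralizer G T"
proof -
  have vc: "v \<in> carrier G" using v by (simp add: centralizer_def)
  have "h \<otimes> v \<otimes> inv h \<otimes> x = x \<otimes> (h \<otimes> v \<otimes> inv h)" if x: "x \<in> T" for x
  proof -
    define y where "y = inv h \<otimes> x \<otimes> h"
    have y: "y \<in> carrier G" "v \<otimes> y = y \<otimes> v" and xy: "x = h \<otimes> y \<otimes> inv h"
      using inva[OF x] x T v h by (auto simp: y_def centralizer_def conj_inv_cancel)
    show ?thesis unfolding xy using conj_mult[OF h vc y(1)] conj_mult[OF h y(1) vc] y(2) by simp
  qed
  then show ?thesis using h vc by (simp add: centralizer_def)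
qed

lemma normal_centralizer:
  assumes T: "T \<subseteq> carrier G" and inva: "\<And>h x. \<lbrakk>h \<in> carrier G; x \<in> T\<rbrakk> \<Longrightarrow> h \<otimes> x \<otimes> inv h \<in> T"
  shows "centralizer G T \<lhd> G"
proof (rule normal_invI[OF subgroup_centralizer[OF T]])
  fix h v assume h: "h \<in> carrier G" and v: "v \<in> centralizer G T"
  have "inv h \<otimes> x \<otimes> h \<in> T" if "x \<in> T" for x
    using inva[of "inv h" x] that h by simp
  then show "h \<otimes> v \<otimes> inv h \<in> centralizer G T" by (rule centralizer_conj[OF T h _ v])
qed

lemma carrier_subset_if_generators:
  assumes "generate G S = carrier G" "subgroup C G" "S \<subseteq> C"
  shows "carrier G \<subseteq> C"
  using generate_subgroup_incl[OF assms(3,2)] assms(1) by simp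

end

text \<open>Closure comes from [x^-1,w] = x^-1 [x,w]^-1 x and [xy,w] = x [y,w] x^-1 [x,w], together
  with normality of \<open>C\<close>. Hence if some commutator with an element of \<open>W\<close>
  lies outside \<open>C\<close>, one with a generator of \<open>G\<close> in the first slot does
  too.\<close>

lemma (in group) subgroup_commutators_in_normal:
  assumes C: "C \<lhd> G" and W: "W \<subseteq> carrier G"
  shows "subgroup {x \<in> carrier G. \<forall>w\<in>W. x \<otimes> w \<otimes> inv x \<otimes> inv w \<in> C} G" (is "subgroup ?H G")
proof (rule subgroupI)
  interpret C: normal C G by (rule C)
  show "?H \<subseteq> carrier G" by blast
  show "?H \<noteq> {}" using W by (auto intro!: exI[of _ \<one>] simp: subset_iff)
  {
    fix x assume x: "x \<in> ?H"
    have "inv x \<otimes> w \<otimes> inv (inv x) \<otimes> inv w \<in> C" if w: "w \<in> W" for w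
    proof -
      have wG: "w \<in> carrier G" and xG: "x \<in> carrier G" using w W x by auto
      have "inv x \<otimes> inv (x \<otimes> w \<otimes> inv x \<otimes> inv w) \<otimes> x \<in> C"
        using x w by (intro C.inv_op_closed1) auto
      then show ?thesis using xG wG by (simp add: m_assoc inv_mult_group)
    qed
    then show "inv x \<in> ?H" using x by simp
  next
    fix x y assume x: "x \<in> ?H" and y: "y \<in> ?H"
    have "(x \<otimes> y) \<otimes> w \<otimes> inv (x \<otimes> y) \<otimes> inv w \<in> C" if w: "w \<in> W" for w
    proof -
      have G: "w \<in> carrier G" "x \<in> carrier G" "y \<in> carrier G" using w W x y by auto
      have "(x \<otimes> (y \<otimes> w \<otimes> inv y \<otimes> inv w) \<otimes> inv x) \<otimes> (x \<otimes> w \<otimes> inv x \<otimes> inv w) \<in> C"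
        using C.m_closed[OF C.inv_op_closed2[OF G(2)]] x y w by blast
      then show ?thesis using G by (simp add: m_assoc inv_mult_group mult_inv_cancel)
    qed
    then show "x \<otimes> y \<in> ?H" using x y by simp
  }
qed

section \<open>Commutator subgroups and the series \<open>Gamma\<close>\<close>

lemma (in group) commutator_subgroup_subset_iff:
  assumes "subgroup C G"
  shows "commutator_subgroup G A B \<subseteq> C \<longleftrightarrow> (\<forall>a\<in>A. \<forall>b\<in>B. a \<otimes> b \<otimes> inv a \<otimes> inv b \<in> C)"
proof
  assume "commutator_subgroup G A B \<subseteq> C"
  then show "\<forall>a\<in>A. \<forall>b\<in>B. a \<otimes> b \<otimes> inv a \<otimes> inv b \<in> C"
    unfolding commutator_subgroup_def by (blast intro: generate.incl)
next
  assume "\<forall>a\<in>A. \<forall>b\<in>B. a \<otimes> b \<otimes> inv a \<otimes> inv b \<in> C"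
  then show "commutator_subgroup G A B \<subseteq> C"
    unfolding commutator_subgroup_def by (intro generate_subgroup_incl[OF _ assms]) blast
qed

lemma (in group) Gamma_closed:
  assumes "N \<subseteq> carrier G"
  shows "Gamma G N i \<subseteq> carrier G"
proof (induction i)
  case (Suc i)
  then show ?case using commutator_subgroup_subset_iff[OF subgroup_self] by (simp add: subset_iff)
qed (use assms in simp)

lemma Gamma_add: "Gamma G N (i + j) = Gamma G (Gamma G N i) j"
  by (induction j) simp_all

lemma (in group) Gamma_mono:
  assumes "N \<subseteq> M"
  shows "Gamma G N i \<subseteq> Gamma G M i"
proof (induction i)
  case (Suc i)
  then show ?case
    unfolding Gamma.simps commutator_subgroup_def by (intro mono_generate) blast
qed (use assms in simp)

lemma (in group) one_in_Gamma:
  assumes "\<one> \<in> N"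
  shows "\<one> \<in> Gamma G N i"
  using assms by (cases i) (auto simp: commutator_subgroup_def intro: generate.one)

text \<open>Homomorphisms preserve commutators and generated subgroups; surjectivity supplies the
  commutators with every element of \<open>H\<close>. This serves both the projection to a quotient
  and the induced map on inner automorphism groups.\<close>

lemma (in group_hom) Gamma_image:
  assumes surj: "h ` carrier G = carrier H" and N: "N \<subseteq> carrier G"
  shows "h ` Gamma G N i = Gamma H (h ` N) i"
proof (induction i)
  case (Suc i)
  let ?\<Gamma> = "Gamma G N i"
  let ?T = "{a \<otimes>\<^bsub>G\<^esub> b \<otimes>\<^bsub>G\<^esub> inv\<^bsub>G\<^esub> a \<otimes>\<^bsub>G\<^esub> inv\<^bsub>G\<^esub> b | a b. a \<in> carrier G \<and> b \<in> ?\<Gamma>}"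
  have \<Gamma>: "?\<Gamma> \<subseteq> carrier G" using N by (rule G.Gamma_closed)
  then have TG: "?T \<subseteq> carrier G" by auto
  have h_comm: "h (a \<otimes>\<^bsub>G\<^esub> b \<otimes>\<^bsub>G\<^esub> inv\<^bsub>G\<^esub> a \<otimes>\<^bsub>G\<^esub> inv\<^bsub>G\<^esub> b)
      = h a \<otimes>\<^bsub>H\<^esub> h b \<otimes>\<^bsub>H\<^esub> inv\<^bsub>H\<^esub> h a \<otimes>\<^bsub>H\<^esub> inv\<^bsub>H\<^esub> h b"
    if "a \<in> carrier G" "b \<in> ?\<Gamma>" for a b
    using that \<Gamma> by (simp add: subset_iff)
  have "h ` ?T = {a \<otimes>\<^bsub>H\<^esub> b \<otimes>\<^bsub>H\<^esub> inv\<^bsub>H\<^esub> a \<otimes>\<^bsub>H\<^esub> inv\<^bsub>H\<^esub> b | a b.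
      a \<in> h ` carrier G \<and> b \<in> h ` ?\<Gamma>}" (is "_ = ?R")
  proof (intro equalityI subsetI)
    fix y assume "y \<in> h ` ?T"
    then obtain a b where ab: "a \<in> carrier G" "b \<in> ?\<Gamma>"
      and "y = h (a \<otimes>\<^bsub>G\<^esub> b \<otimes>\<^bsub>G\<^esub> inv\<^bsub>G\<^esub> a \<otimes>\<^bsub>G\<^esub> inv\<^bsub>G\<^esub> b)" by blast
    then show "y \<in> ?R" using h_comm[OF ab] by blast
  next
    fix y assume "y \<in> ?R"
    then obtain a b where ab: "a \<in> carrier G" "b \<in> ?\<Gamma>"
      and "y = h a \<otimes>\<^bsub>H\<^esub> h b \<otimes>\<^bsub>H\<^esub> inv\<^bsub>H\<^esub> h a \<otimes>\<^bsub>H\<^esub> inv\<^bsub>H\<^esub> h b" by blast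
    then have "y = h (a \<otimes>\<^bsub>G\<^esub> b \<otimes>\<^bsub>G\<^esub> inv\<^bsub>G\<^esub> a \<otimes>\<^bsub>G\<^esub> inv\<^bsub>G\<^esub> b)" by (simp only: h_comm[OF ab])
    then show "y \<in> h ` ?T" using ab by blast
  qed
  then show ?case
    using generate_img[OF TG] by (simp only: Gamma.simps commutator_subgroup_def surj Suc)
qed simp

lemma (in group_hom) normal_preimage:
  assumes "M \<lhd> H"
  shows "{x \<in> carrier G. h x \<in> M} \<lhd> G"
proof (rule G.normal_invI)
  interpret M: normal M H by (rule assms)
  show "subgroup {x \<in> carrier G. h x \<in> M} G"
    by (rule G.subgroupI) (auto intro: exI[of _ "\<one>\<^bsub>G\<^esub>"])
  show "x \<otimes>\<^bsub>G\<^esub> y \<otimes>\<^bsub>G\<^esub> inv\<^bsub>G\<^esub> x \<in> {x \<in> carrier G. h x \<in> M}"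
    if "x \<in> carrier G" "y \<in> {x \<in> carrier G. h x \<in> M}" for x y
    using that M.inv_op_closed2[of "h x" "h y"] by simp
qed

section \<open>Minimal normal subgroups\<close>

text \<open>The trivial group also satisfies this condition; nontriviality of \<open>K\<close> is
  derived where it matters.\<close>

locale minimal_normal = normal K G for K and G (structure) +
  assumes minimal: "\<lbrakk>N \<lhd> G; N \<subseteq> K\<rbrakk> \<Longrightarrow> N = {\<one>} \<or> N = K"
begin

text \<open>The centralizer of a conjugation-invariant set is normal, so its intersection with
  \<open>K\<close> is normal in \<open>G\<close>. The element \<open>v\<close> makes the
  intersection nontrivial, and minimality makes it all of \<open>K\<close>.\<close>

lemma subset_centralizer:
  assumes T: "T \<subseteq> carrier G" and inva: "\<And>h x. \<lbrakk>h \<in> carrier G; x \<in> T\<rbrakk> \<Longrightarrow> h \<otimes> x \<otimes> inv h \<in> T"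
    and v: "v \<in> K" "v \<noteq> \<one>" "v \<in> centralizer G T"
  shows "K \<subseteq> centralizer G T"
  using minimal[OF normal_subgroup_intersect[OF normal_axioms normal_centralizer[OF T inva]]] v by blast

text \<open>Take a smallest such subgroup \<open>M\<close>. By minimality it meets each conjugate $hMh^{-1}$ in the
  trivial group or in \<open>M\<close>, so it commutes with all its conjugates and hence with \<open>K\<close>.\<close>

lemma abelian_if_abelian_subgroup:
  assumes fin: "finite K" and A: "subgroup A G" "A \<subseteq> K" "A \<noteq> {\<one>}"
    and abel: "\<And>a b. \<lbrakk>a \<in> A; b \<in> A\<rbrakk> \<Longrightarrow> a \<otimes> b = b \<otimes> a"
    and inva: "\<And>v a. \<lbrakk>v \<in> K; a \<in> A\<rbrakk> \<Longrightarrow> v \<otimes> a \<otimes> inv v \<in> A"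
  shows "K \<subseteq> centralizer G K"
proof -
  define \<A> where "\<A> = {A. subgroup A G \<and> A \<subseteq> K \<and> A \<noteq> {\<one>} \<and> (\<forall>a\<in>A. \<forall>b\<in>A. a \<otimes> b = b \<otimes> a) \<and>
     (\<forall>v\<in>K. \<forall>a\<in>A. v \<otimes> a \<otimes> inv v \<in> A)}"
  have "A \<in> \<A>" using A abel inva by (auto simp: \<A>_def)
  then obtain M where M: "M \<in> \<A>" and min: "\<And>B. B \<in> \<A> \<Longrightarrow> card M \<le> card B"
    using ex_has_least_nat[of "\<lambda>A. A \<in> \<A>" A card] by auto
  from M have sub: "subgroup M G" and MK: "M \<subseteq> K" and M1: "M \<noteq> {\<one>}"
    and Mabel: "\<And>a b. \<lbrakk>a \<in> M; b \<in> M\<rbrakk> \<Longrightarrow> a \<otimes> b = b \<otimes> a"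
    and Minv: "\<And>v a. \<lbrakk>v \<in> K; a \<in> M\<rbrakk> \<Longrightarrow> v \<otimes> a \<otimes> inv v \<in> M"
    by (auto simp: \<A>_def)
  have finM: "finite M" using fin MK finite_subset by blast
  interpret M: subgroup M G by (rule sub)
  define T where "T = {h \<otimes> a \<otimes> inv h | h a. h \<in> carrier G \<and> a \<in> M}"
  have XG: "T \<subseteq> carrier G" by (auto simp: T_def)
  have Xinv: "h \<otimes> x \<otimes> inv h \<in> T" if h: "h \<in> carrier G" and x: "x \<in> T" for h x
  proof -
    obtain k a where ka: "k \<in> carrier G" "a \<in> M" "x = k \<otimes> a \<otimes> inv k" using x by (auto simp: T_def)
    then have "h \<otimes> x \<otimes> inv h = (h \<otimes> k) \<otimes> a \<otimes> inv (h \<otimes> k)" using h by (simp add: conj_compose)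
    then show ?thesis using ka h by (force simp: T_def)
  qed
  have MX: "M \<subseteq> T" by (force simp: T_def intro: exI[of _ \<one>])
  have comm: "b \<otimes> (h \<otimes> a \<otimes> inv h) = (h \<otimes> a \<otimes> inv h) \<otimes> b"
    if h: "h \<in> carrier G" and a: "a \<in> M" and b: "b \<in> M" for h a b
  proof -
    \<comment> \<open>\<open>B\<close> is the intersection of \<open>M\<close> with h M h^-1. It is
      again invariant under \<open>K\<close> because \<open>K\<close> is normal, so the choice of
      \<open>M\<close> leaves only two possibilities.\<close>
    define B where "B = {x \<in> M. inv h \<otimes> x \<otimes> h \<in> M}"
    have conj_mult': "inv h \<otimes> (x \<otimes> y) \<otimes> h = (inv h \<otimes> x \<otimes> h) \<otimes> (inv h \<otimes> y \<otimes> h)"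
      if "x \<in> M" "y \<in> M" for x y
      using conj_mult[of "inv h" x y] that h by simp
    have conj_inv': "inv h \<otimes> inv x \<otimes> h = inv (inv h \<otimes> x \<otimes> h)" if "x \<in> M" for x
      using that h by (simp add: inv_mult_group m_assoc)
    have Bsub: "subgroup B G"
    proof (rule subgroupI)
      show "B \<subseteq> carrier G" by (auto simp: B_def)
      show "B \<noteq> {}" using h by (auto simp: B_def intro!: exI[of _ \<one>])
    qed (auto simp: B_def conj_mult' conj_inv')
    have Binv: "v \<otimes> x \<otimes> inv v \<in> B" if v: "v \<in> K" and x: "x \<in> B" for v x
    proof -
      have xM: "x \<in> M" "inv h \<otimes> x \<otimes> h \<in> M" using x by (auto simp: B_def)
      define w where "w = inv h \<otimes> v \<otimes> h"
      have w: "w \<in> K" using inv_op_closed1[OF h v] by (simp add: w_def)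
      have "inv h \<otimes> (v \<otimes> x \<otimes> inv v) \<otimes> h = w \<otimes> (inv h \<otimes> x \<otimes> h) \<otimes> inv w"
        using h mem_carrier[OF v] xM(1) by (simp add: w_def m_assoc inv_mult_group mult_inv_cancel)
      then show ?thesis using Minv[OF w xM(2)] Minv[OF v xM(1)] by (simp add: B_def)
    qed
    have BM: "B \<subseteq> M" by (auto simp: B_def)
    consider "B = {\<one>}" | "B = M"
    proof (cases "B = {\<one>}")
      case False
      moreover have "\<forall>a\<in>B. \<forall>b\<in>B. a \<otimes> b = b \<otimes> a" using BM Mabel by blast
      ultimately have "B \<in> \<A>" using Bsub BM MK Binv by (simp add: \<A>_def)
      then show ?thesis using min card_seteq[OF finM BM] that by blast
    qed
    then show ?thesis
    proof cases
      case 1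
      \<comment> \<open>Both \<open>b\<close> and \<open>c\<close> lie in \<open>K\<close>, so
        \<open>c\<close> normalizes \<open>M\<close> and \<open>b\<close> normalizes h M h^-1. Hence
        [b,c] lies in both groups, that is, in the trivial group \<open>B\<close>.\<close>
      define c where "c = h \<otimes> a \<otimes> inv h"
      have aK: "a \<in> K" and bK: "b \<in> K" using a b MK by auto
      have c: "c \<in> K" using inv_op_closed2[OF h aK] by (simp add: c_def)
      have cc: "c \<in> carrier G" using c by simp
      have ic: "inv h \<otimes> c \<otimes> h = a" using conj_inv_cancel[OF h, of a] a by (simp add: c_def)
      have "b \<otimes> c \<otimes> inv b \<otimes> inv c \<in> M"
      proof -
        have "b \<otimes> (c \<otimes> inv b \<otimes> inv c) \<in> M" using Minv[OF c, of "inv b"] b by simp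
        then show ?thesis using b cc by (simp add: m_assoc)
      qed
      moreover have "inv h \<otimes> (b \<otimes> c \<otimes> inv b \<otimes> inv c) \<otimes> h \<in> M"
      proof -
        define d where "d = inv h \<otimes> b \<otimes> h"
        have d: "d \<in> K" using inv_op_closed1[OF h bK] by (simp add: d_def)
        have "inv h \<otimes> (b \<otimes> c \<otimes> inv b \<otimes> inv c) \<otimes> h = (d \<otimes> a \<otimes> inv d) \<otimes> inv a"
          using h b cc by (simp add: ic[symmetric] d_def m_assoc inv_mult_group mult_inv_cancel)
        then show ?thesis using Minv[OF d a] a by simp
      qed
      ultimately have "b \<otimes> c \<otimes> inv b \<otimes> inv c \<in> B" by (simp add: B_def)
      then have "b \<otimes> c = c \<otimes> b" using 1 commute_iff_commutator[of b c] b cc by simp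
      then show ?thesis by (simp add: c_def)
    next
      case 2
      then have "inv h \<otimes> b \<otimes> h \<in> M" using b by (auto simp: B_def)
      then have "(inv h \<otimes> b \<otimes> h) \<otimes> a = a \<otimes> (inv h \<otimes> b \<otimes> h)" using a by (rule Mabel)
      then have "h \<otimes> ((inv h \<otimes> b \<otimes> h) \<otimes> a) \<otimes> inv h = h \<otimes> (a \<otimes> (inv h \<otimes> b \<otimes> h)) \<otimes> inv h" by simp
      then show ?thesis using a b h by (simp add: m_assoc mult_inv_cancel)
    qed
  qed
  \<comment> \<open>Minimality is used twice: \<open>m\<close> centralizes \<open>T\<close>, so all
    of \<open>K\<close> does; since \<open>m\<close> itself is in \<open>T\<close>, it then
    centralizes \<open>K\<close>, so all of \<open>K\<close> does.\<close>
  obtain m where m: "m \<in> M" "m \<noteq> \<one>" using M1 M.one_closed by blast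
  have "m \<in> centralizer G T" using m comm by (auto simp: centralizer_def T_def)
  then have KX: "K \<subseteq> centralizer G T" using subset_centralizer[OF XG Xinv, of m] m MK by blast
  have "m \<in> centralizer G K" using KX m MX by (fastforce simp: centralizer_def)
  then show ?thesis
    using subset_centralizer[OF subset inv_op_closed2, of m] m MK by blast
qed

text \<open>The assumption \<open>comm\<close> says $[g,[g,v]] = 1$, i.e. each generator $g$ acts on \<open>K\<close> as a square-zero
  perturbation of the identity.\<close>

context
  fixes S
  assumes S: "S \<subseteq> carrier G" and gen: "generate G S = carrier G"
    and comm: "\<lbrakk>g \<in> S; v \<in> K\<rbrakk> \<Longrightarrow> g \<otimes> (v \<otimes> g \<otimes> inv v) = (v \<otimes> g \<otimes> inv v) \<otimes> g"
begin

lemma abelian_if_commuting_conjugates: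
  assumes fin: "finite K"
  shows "K \<subseteq> centralizer G K"
proof (cases "S \<subseteq> centralizer G K")
  case True
  then show ?thesis using carrier_subset_if_generators[OF gen subgroup_centralizer[OF subset]] subset by blast
next
  case False
  then obtain g p where g: "g \<in> S" and p: "p \<in> K" and gp: "g \<otimes> p \<noteq> p \<otimes> g"
    using S by (auto simp: centralizer_def)
  have gG: "g \<in> carrier G" and pG: "p \<in> carrier G" using g S p by auto
  \<comment> \<open>The \<open>K\<close>-conjugates \<open>T\<close> of \<open>g\<close> commute with each other, so $[g,p] \in \langle T \rangle \cap K$ lies in
    \<open>A\<close>, the centre of the centralizer of \<open>T\<close> in \<open>K\<close>.\<close>
  define T where "T = {v \<otimes> g \<otimes> inv v | v. v \<in> K}"
  define D where "D = K \<inter> centralizer G T"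
  define A where "A = D \<inter> centralizer G D"
  have TG: "T \<subseteq> carrier G" using gG by (auto simp: T_def)
  have DG: "D \<subseteq> carrier G" by (auto simp: D_def)
  have Tconj: "v \<otimes> t \<otimes> inv v \<in> T" if "v \<in> K" "t \<in> T" for v t
  proof -
    obtain w where w: "w \<in> K" "t = w \<otimes> g \<otimes> inv w" using \<open>t \<in> T\<close> by (auto simp: T_def)
    then have "v \<otimes> t \<otimes> inv v = (v \<otimes> w) \<otimes> g \<otimes> inv (v \<otimes> w)" using that gG by (simp add: conj_compose)
    then show ?thesis using w that by (auto simp: T_def)
  qed
  have gT: "g \<in> T" using gG by (auto simp: T_def intro!: exI[of _ \<one>])
  \<comment> \<open>Conjugation by v^-1 turns the pair \<open>s\<close>, \<open>t\<close> into
    \<open>g\<close> and another element of \<open>T\<close>, where \<open>comm\<close>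
    applies.\<close>
  have TT: "T \<subseteq> centralizer G T"
  proof -
    have "s \<otimes> t = t \<otimes> s" if s: "s \<in> T" and t: "t \<in> T" for s t
    proof -
      obtain v where v: "v \<in> K" "s = v \<otimes> g \<otimes> inv v" using s by (auto simp: T_def)
      have tG: "t \<in> carrier G" using t TG by blast
      define r where "r = inv v \<otimes> t \<otimes> v"
      have "r \<in> T" using Tconj[of "inv v" t] v t by (simp add: r_def)
      then have gr: "g \<otimes> r = r \<otimes> g" and rG: "r \<in> carrier G" using comm[OF g] TG by (auto simp: T_def)
      have tr: "t = v \<otimes> r \<otimes> inv v" using v tG by (simp add: r_def conj_inv_cancel)
      show ?thesis unfolding v(2) tr using conj_mult[of v g r] conj_mult[of v r g] v(1) gG rG gr by simp
    qed
    then show ?thesis using TG by (auto simp: centralizer_def)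
  qed
  have TD: "T \<subseteq> centralizer G D" using TG by (fastforce simp: D_def centralizer_def)
  have subT: "subgroup (centralizer G T) G" and subD: "subgroup (centralizer G D) G"
    using subgroup_centralizer TG DG by blast+
  have Dsub: "subgroup D G"
    unfolding D_def by (rule subgroups_Inter_pair[OF subgroup_axioms subT])
  have Asub: "subgroup A G"
    unfolding A_def by (rule subgroups_Inter_pair[OF Dsub subD])
  have Dconj: "v \<otimes> d \<otimes> inv v \<in> D" if v: "v \<in> K" and d: "d \<in> D" for v d
  proof -
    have "inv v \<otimes> t \<otimes> v \<in> T" if "t \<in> T" for t using Tconj[of "inv v" t] v that by simp
    then have "v \<otimes> d \<otimes> inv v \<in> centralizer G T"
      using d v by (intro centralizer_conj[OF TG]) (auto simp: D_def)
    then show ?thesis using v d by (simp add: D_def)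
  qed
  have Aconj: "v \<otimes> a \<otimes> inv v \<in> A" if v: "v \<in> K" and a: "a \<in> A" for v a
  proof -
    have "inv v \<otimes> t \<otimes> v \<in> D" if "t \<in> D" for t using Dconj[of "inv v" t] v that by simp
    then have "v \<otimes> a \<otimes> inv v \<in> centralizer G D"
      using a v by (intro centralizer_conj[OF DG]) (auto simp: A_def)
    then show ?thesis using v a Dconj by (simp add: A_def)
  qed
  define u where "u = g \<otimes> p \<otimes> inv g \<otimes> inv p"
  define t where "t = p \<otimes> g \<otimes> inv p"
  have t: "t \<in> T" using p by (auto simp: t_def T_def)
  have ut: "u = g \<otimes> inv t" using gG pG by (simp add: u_def t_def m_assoc inv_mult_group)
  have uK: "u \<in> K" using inv_op_closed2[OF gG p] p by (simp add: u_def)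
  \<comment> \<open>As a quotient of two elements of \<open>T\<close>, \<open>u\<close> lies in
    every subgroup containing \<open>T\<close>. The centralizers of \<open>T\<close> and of
    \<open>D\<close> are two such subgroups.\<close>
  have "u \<in> C" if "subgroup C G" "T \<subseteq> C" for C
    unfolding ut using that gT t by (meson subgroup.m_closed subgroup.m_inv_closed subsetD)
  then have "u \<in> A" using subT subD TT TD uK by (simp add: A_def D_def)
  moreover have "u \<noteq> \<one>" using gp commute_iff_commutator[OF gG pG] by (simp add: u_def)
  ultimately have "A \<noteq> {\<one>}" by blast
  moreover have "A \<subseteq> K" by (auto simp: A_def D_def)
  moreover have "a \<otimes> b = b \<otimes> a" if "a \<in> A" "b \<in> A" for a b
    using that unfolding A_def centralizer_def by blast
  ultimately show ?thesis using abelian_if_abelian_subgroup[OF fin Asub _ _ _ Aconj] by blast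
qed

text \<open>For nontrivial \<open>w\<close> in \<open>W\<close>, the commutator [g,w] = g (w g
  w^-1)^-1 is a product of elements commuting with \<open>g\<close>, so \<open>g\<close> fixes it.
  If it is trivial, then \<open>w\<close> itself is fixed.\<close>

lemma fixed_point:
  assumes g: "g \<in> S" and W: "subgroup W G" "W \<subseteq> K" "W \<noteq> {\<one>}"
    and conj: "\<And>w. w \<in> W \<Longrightarrow> g \<otimes> w \<otimes> inv g \<in> W"
  obtains v where "v \<in> W" "v \<noteq> \<one>" "v \<otimes> g = g \<otimes> v"
proof -
  interpret W: subgroup W G by (rule W)
  obtain w where w: "w \<in> W" "w \<noteq> \<one>" using W(3) W.one_closed by blast
  have gG: "g \<in> carrier G" using g S by blast
  define t where "t = w \<otimes> g \<otimes> inv w"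
  define u where "u = g \<otimes> w \<otimes> inv g \<otimes> inv w"
  have uW: "u \<in> W" using conj[OF w(1)] w(1) by (simp add: u_def)
  have ut: "u = g \<otimes> inv t" using gG w by (simp add: u_def t_def m_assoc inv_mult_group)
  have subg: "subgroup (centralizer G {g}) G" using subgroup_centralizer gG by blast
  have "t \<in> centralizer G {g}" using comm[OF g, of w] w W(2) gG by (auto simp: centralizer_def t_def)
  moreover have "g \<in> centralizer G {g}" using gG by (simp add: centralizer_def)
  ultimately have "u \<in> centralizer G {g}"
    unfolding ut by (meson subg subgroup.m_closed subgroup.m_inv_closed)
  then have ug: "u \<otimes> g = g \<otimes> u" by (simp add: centralizer_def)
  show ?thesis
  proof (cases "u = \<one>")
    case True
    then have "w \<otimes> g = g \<otimes> w" using commute_iff_commutator[of g w] gG w by (simp add: u_def)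
    then show ?thesis using w that by blast
  next
    case False
    then show ?thesis using uW ug that by blast
  qed
qed

end

section \<open>The action of \<open>G\<close> on a minimal normal subgroup\<close>

lemma central_if_generators:
  assumes fin: "finite K"
    and S: "S \<subseteq> carrier G" and gen: "generate G S = carrier G"
    and comm: "\<And>g v. \<lbrakk>g \<in> S; v \<in> K\<rbrakk> \<Longrightarrow> g \<otimes> (v \<otimes> g \<otimes> inv v) = (v \<otimes> g \<otimes> inv v) \<otimes> g"
    and Sconj: "\<And>h g. \<lbrakk>h \<in> carrier G; g \<in> S\<rbrakk> \<Longrightarrow> h \<otimes> g \<otimes> inv h \<in> S"
    and nilp: "Gamma G (carrier G) c \<subseteq> K"
  shows "carrier G \<subseteq> centralizer G K"
proof (rule ccontr)
  let ?C = "centralizer G K" and ?\<Gamma> = "Gamma G (carrier G)"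
  assume not: "\<not> carrier G \<subseteq> ?C"
  have normC: "?C \<lhd> G" using normal_centralizer[OF subset] inv_op_closed2 by blast
  then have subC: "subgroup ?C G" by (rule normal_imp_subgroup)
  \<comment> \<open>\<open>K\<close> is abelian, so it lies in its own centralizer and the
    \<open>c\<close>-th term acts trivially on it. The index \<open>j\<close> then marks a term that
    acts nontrivially while its successor acts trivially.\<close>
  have "?\<Gamma> c \<subseteq> ?C" using nilp abelian_if_commuting_conjugates[OF S gen comm fin] by blast
  moreover have "\<not> ?\<Gamma> 0 \<subseteq> ?C" using not by simp
  ultimately obtain j where j: "\<not> ?\<Gamma> j \<subseteq> ?C" "?\<Gamma> (Suc j) \<subseteq> ?C"
    using ex_least_nat_less[of "\<lambda>i. ?\<Gamma> i \<subseteq> ?C" c] by blast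
  have central: "h \<otimes> z \<otimes> inv h \<otimes> inv z \<in> ?C" if "h \<in> carrier G" "z \<in> ?\<Gamma> j" for h z
    using j(2) that by (simp add: commutator_subgroup_subset_iff[OF subC])
  \<comment> \<open>\<open>z\<close> is central modulo the centralizer of \<open>K\<close>, so its fixed points in \<open>K\<close> are normal in \<open>G\<close>.\<close>
  have no_fixed: "z \<in> ?C" if z: "z \<in> ?\<Gamma> j" and v: "v \<in> K" "v \<noteq> \<one>" "v \<otimes> z = z \<otimes> v" for z v
  proof -
    have zG: "z \<in> carrier G" using z Gamma_closed by blast
    define T where "T = {h \<otimes> z \<otimes> inv h | h. h \<in> carrier G}"
    have TG: "T \<subseteq> carrier G" using zG by (auto simp: T_def)
    have Tconj: "h \<otimes> t \<otimes> inv h \<in> T" if h: "h \<in> carrier G" and t: "t \<in> T" for h t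
    proof -
      obtain k where k: "k \<in> carrier G" "t = k \<otimes> z \<otimes> inv k" using t by (auto simp: T_def)
      have "h \<otimes> t \<otimes> inv h = (h \<otimes> k) \<otimes> z \<otimes> inv (h \<otimes> k)"
        unfolding k(2) by (rule conj_compose[OF h k(1) zG])
      then show ?thesis using k(1) h by (auto simp: T_def)
    qed
    have vG: "v \<in> carrier G" using v by simp
    have subv: "subgroup (centralizer G {v}) G" using subgroup_centralizer vG by blast
    have "t \<in> centralizer G {v}" if "t \<in> T" for t
    proof -
      obtain h where h: "h \<in> carrier G" "t = h \<otimes> z \<otimes> inv h" using \<open>t \<in> T\<close> by (auto simp: T_def)
      \<comment> \<open>Use h z h^-1 = [h,z] z, where both factors commute with
        \<open>v\<close>.\<close>
      have "h \<otimes> z \<otimes> inv h \<otimes> inv z \<in> centralizer G {v}"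
        using central[OF h(1) z] v(1) unfolding centralizer_def by blast
      moreover have "z \<in> centralizer G {v}" using v(3) zG by (simp add: centralizer_def)
      ultimately have "(h \<otimes> z \<otimes> inv h \<otimes> inv z) \<otimes> z \<in> centralizer G {v}" by (rule subgroup.m_closed[OF subv])
      then show ?thesis using h zG by (simp add: m_assoc)
    qed
    then have "v \<in> centralizer G T" using vG by (simp add: centralizer_def)
    then have "K \<subseteq> centralizer G T" using subset_centralizer[OF TG Tconj] v by blast
    moreover have "z \<in> T" using zG by (auto simp: T_def intro!: exI[of _ \<one>])
    ultimately show ?thesis using zG by (fastforce simp: centralizer_def)
  qed
  have "K \<noteq> {\<one>}" using not by (auto simp: centralizer_def)
  then have fixK: thesis
    if "g \<in> S" "\<And>v. \<lbrakk>v \<in> K; v \<noteq> \<one>; v \<otimes> g = g \<otimes> v\<rbrakk> \<Longrightarrow> thesis" for g thesis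
    using fixed_point[OF S gen comm that(1) subgroup_axioms _ _ inv_op_closed2] that S by blast
  show False
  proof (cases j)
    case 0
    obtain g where g: "g \<in> S" "g \<notin> ?C"
      using carrier_subset_if_generators[OF gen subC] not by blast
    then show False using fixK[OF g(1)] no_fixed[of g] S 0 by auto
  next
    case (Suc i)
    have \<Gamma>i: "?\<Gamma> i \<subseteq> carrier G" by (simp add: Gamma_closed)
    \<comment> \<open>\<open>?H\<close> is a subgroup, so if it is not all of \<open>G\<close>, it
      already misses a generator.\<close>
    let ?H = "{x \<in> carrier G. \<forall>w\<in>?\<Gamma> i. x \<otimes> w \<otimes> inv x \<otimes> inv w \<in> ?C}"
    have "\<not> carrier G \<subseteq> ?H"
      using j(1) Suc by (auto simp: commutator_subgroup_subset_iff[OF subC])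
    then have "\<not> S \<subseteq> ?H"
      using carrier_subset_if_generators[OF gen subgroup_commutators_in_normal[OF normC \<Gamma>i]] by blast
    then obtain g w where g: "g \<in> S" and w: "w \<in> ?\<Gamma> i"
      and notC: "g \<otimes> w \<otimes> inv g \<otimes> inv w \<notin> ?C" using S by blast
    have gG: "g \<in> carrier G" and wG: "w \<in> carrier G" using g S w \<Gamma>i by auto
    \<comment> \<open>\<open>z\<close> is a quotient of two generators that commute in their action on \<open>K\<close>; they have a common
      fixed point, which \<open>z\<close> then fixes as well.\<close>
    define z a where "z = g \<otimes> w \<otimes> inv g \<otimes> inv w" and "a = w \<otimes> g \<otimes> inv w"
    have z: "z \<in> ?\<Gamma> j"
      unfolding Suc z_def using gG w by (auto simp: commutator_subgroup_def intro!: generate.incl)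
    have zG: "z \<in> carrier G" and aG: "a \<in> carrier G" using gG wG by (simp_all add: z_def a_def)
    have aS: "a \<in> S" using Sconj[OF wG g] by (simp add: a_def)
    have za: "z = g \<otimes> inv a" and az: "a = inv z \<otimes> g"
      using gG wG by (simp_all add: z_def a_def m_assoc inv_mult_group mult_inv_cancel)
    define W where "W = K \<inter> centralizer G {g}"
    have subW: "subgroup W G"
      unfolding W_def using gG by (intro subgroups_Inter_pair subgroup_axioms subgroup_centralizer) simp
    obtain v0 where "v0 \<in> K" "v0 \<noteq> \<one>" "v0 \<otimes> g = g \<otimes> v0" using fixK[OF g] by blast
    then have "v0 \<in> W" by (simp add: W_def centralizer_def)
    then have W1: "W \<noteq> {\<one>}" using \<open>v0 \<noteq> \<one>\<close> by blast
    \<comment> \<open>On \<open>W\<close> the element a = z^-1 g acts as z^-1. Since b = [g,z] acts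
      trivially on \<open>K\<close>, the actions of \<open>g\<close> and \<open>z\<close> commute,
      so \<open>g\<close> fixes a v a^-1 as well.\<close>
    have Wa: "a \<otimes> v \<otimes> inv a \<in> W" if v: "v \<in> W" for v
    proof -
      have vK: "v \<in> K" and vg: "v \<otimes> g = g \<otimes> v" using v by (auto simp: W_def centralizer_def)
      have vG: "v \<in> carrier G" using vK by simp
      define b where "b = g \<otimes> z \<otimes> inv g \<otimes> inv z"
      have bG: "b \<in> carrier G" and bv: "b \<otimes> v = v \<otimes> b"
        using central[OF gG z] vK by (auto simp: b_def centralizer_def)
      have gz: "g \<otimes> z \<otimes> inv g = b \<otimes> z" using gG zG by (simp add: b_def m_assoc)
      have gvg: "g \<otimes> v \<otimes> inv g = v" using commute_iff_conj[OF gG vG] vg by simp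
      have bvb: "inv b \<otimes> v \<otimes> b = v" using bG vG bv by (simp add: m_assoc mult_inv_cancel flip: bv)
      have "a \<otimes> v \<otimes> inv a = inv z \<otimes> (g \<otimes> v \<otimes> inv g) \<otimes> z"
        using gG zG vG by (simp add: az m_assoc inv_mult_group)
      then have avz: "a \<otimes> v \<otimes> inv a = inv z \<otimes> v \<otimes> z" by (simp add: gvg)
      have "g \<otimes> (inv z \<otimes> v \<otimes> z) \<otimes> inv g
          = inv (g \<otimes> z \<otimes> inv g) \<otimes> (g \<otimes> v \<otimes> inv g) \<otimes> (g \<otimes> z \<otimes> inv g)"
        using gG zG vG by (simp add: m_assoc inv_mult_group mult_inv_cancel)
      also have "\<dots> = inv z \<otimes> (inv b \<otimes> v \<otimes> b) \<otimes> z"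
        unfolding gz gvg using zG vG bG by (simp add: m_assoc inv_mult_group)
      finally have "g \<otimes> (a \<otimes> v \<otimes> inv a) \<otimes> inv g = a \<otimes> v \<otimes> inv a" by (simp add: bvb avz)
      then have "g \<otimes> (a \<otimes> v \<otimes> inv a) = (a \<otimes> v \<otimes> inv a) \<otimes> g"
        using commute_iff_conj[of g "a \<otimes> v \<otimes> inv a"] gG aG vG by simp
      then show ?thesis using inv_op_closed2[OF aG vK] aG vG by (simp add: W_def centralizer_def)
    qed
    have "W \<subseteq> K" by (simp add: W_def)
    then obtain v where v: "v \<in> W" "v \<noteq> \<one>" "v \<otimes> a = a \<otimes> v"
      using fixed_point[OF S gen comm aS subW _ W1 Wa] by blast
    have subv: "subgroup (centralizer G {v}) G"
      using subgroup_centralizer[of "{v}"] v(1) by (auto simp: W_def)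
    have "g \<in> centralizer G {v}" "a \<in> centralizer G {v}"
      using v gG aG by (auto simp: W_def centralizer_def)
    then have "z \<in> centralizer G {v}"
      unfolding za by (meson subv subgroup.m_closed subgroup.m_inv_closed)
    then have "z \<in> ?C" using no_fixed[OF z, of v] v by (simp add: W_def centralizer_def)
    then show False using notC by (simp add: z_def)
  qed
qed

end

section \<open>Induction along a chief series\<close>

text \<open>Correspondence theorem: the preimage \<open>L\<close> of a normal subgroup
  \<open>M\<close> of the quotient lies between \<open>N\<close> and \<open>K\<close>, and
  \<open>M\<close> is recovered as the image of \<open>L\<close>.\<close>

lemma (in group) minimal_normal_quotient:
  assumes N: "N \<lhd> G" and K: "K \<lhd> G" and NK: "N \<subseteq> K"
    and maximal: "\<And>L. \<lbrakk>L \<lhd> G; N \<subseteq> L; L \<subseteq> K\<rbrakk> \<Longrightarrow> L = N \<or> L = K"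
  shows "minimal_normal ((#>) N ` K) (G Mod N)"
proof -
  interpret N: normal N G by (rule N)
  interpret K: normal K G by (rule K)
  interpret H: group "G Mod N" by (rule N.factorgroup_is_group)
  interpret \<pi>: group_hom G "G Mod N" "(#>) N"
    by (intro group_hom.intro group_hom_axioms.intro N.r_coset_hom_Mod) unfold_locales
  have surj: "(#>) N ` carrier G = carrier (G Mod N)" by (simp add: carrier_FactGroup)
  have ker: "x \<in> N" if "x \<in> carrier G" "N #> x = \<one>\<^bsub>G Mod N\<^esub>" for x
    using that coset_join1[OF _ _ N.subgroup_axioms] by simp
  have inK: "x \<in> K" if x: "x \<in> carrier G" and k: "k \<in> K" and eq: "N #> x = N #> k" for x k
  proof -
    have "x \<in> N #> k" using rcos_self[OF x N.subgroup_axioms] eq by simp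
    then obtain n where "n \<in> N" "x = n \<otimes> k" by (auto simp: r_coset_def)
    then show ?thesis using NK k by blast
  qed
  show ?thesis
  proof (intro minimal_normal.intro minimal_normal_axioms.intro)
    show "(#>) N ` K \<lhd> G Mod N"
      by (rule K.surj_hom_normal_subgroup[OF \<pi>.group_hom_axioms surj])
    fix M assume M: "M \<lhd> G Mod N" and MK: "M \<subseteq> (#>) N ` K"
    interpret M: normal M "G Mod N" by (rule M)
    define L where "L = {x \<in> carrier G. N #> x \<in> M}"
    have L: "L \<lhd> G" unfolding L_def by (rule \<pi>.normal_preimage[OF M])
    have NL: "N \<subseteq> L"
    proof
      fix x assume x: "x \<in> N"
      then have "N #> x = \<one>\<^bsub>G Mod N\<^esub>" using coset_join2[OF _ N.subgroup_axioms] by simp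
      then show "x \<in> L" using x M.one_closed by (simp add: L_def)
    qed
    have LK: "L \<subseteq> K" using MK inK by (auto simp: L_def)
    have M_eq: "M = (#>) N ` L" using MK by (auto simp: L_def)
    from maximal[OF L NL LK] show "M = {\<one>\<^bsub>G Mod N\<^esub>} \<or> M = (#>) N ` K"
    proof
      assume "L = N"
      then have "M \<subseteq> {\<one>\<^bsub>G Mod N\<^esub>}"
        using M_eq coset_join2[OF _ N.subgroup_axioms] by auto
      then show ?thesis using M.one_closed by blast
    qed (simp add: M_eq)
  qed
qed

text \<open>Choose \<open>N\<close> maximal among the normal subgroups of \<open>G\<close> properly
  inside \<open>K\<close>. Then K/N is central in G/N, so [G,K] lies in \<open>N\<close>, and the
  induction hypothesis applies to \<open>N\<close>. The index \<open>c\<close> has to vary in the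
  induction because it grows by one at each step.\<close>

lemma (in group) Gamma_eventually_trivial:
  assumes "K \<lhd> G" "finite K"
    and S: "S \<subseteq> carrier G" and gen: "generate G S = carrier G"
    and comm: "\<And>g v. \<lbrakk>g \<in> S; v \<in> K\<rbrakk> \<Longrightarrow> g \<otimes> (v \<otimes> g \<otimes> inv v) = (v \<otimes> g \<otimes> inv v) \<otimes> g"
    and Sconj: "\<And>h g. \<lbrakk>h \<in> carrier G; g \<in> S\<rbrakk> \<Longrightarrow> h \<otimes> g \<otimes> inv h \<in> S"
    and "Gamma G (carrier G) c \<subseteq> K"
  shows "\<exists>d. Gamma G K d = {\<one>}"
  using assms(1,2,5,7)
proof (induction "card K" arbitrary: K c rule: less_induct)
  case less
  note K = less.prems(1) and fin = less.prems(2) and comm = less.prems(3) and nilp = less.prems(4)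
  interpret K: normal K G by (rule K)
  show ?case
  proof (cases "K = {\<one>}")
    case True
    then show ?thesis by (intro exI[of _ 0]) simp
  next
    case False
    define \<N> where "\<N> = {N. N \<lhd> G \<and> N \<subset> K}"
    have "finite \<N>" unfolding \<N>_def by (rule finite_subset[of _ "Pow K"]) (use fin in auto)
    moreover have "{\<one>} \<in> \<N>" using False one_is_normal K.one_closed by (auto simp: \<N>_def)
    ultimately obtain N where "N \<in> \<N>" and max: "\<forall>L\<in>\<N>. N \<subseteq> L \<longrightarrow> N = L"
      using finite_has_maximal[of \<N>] by auto
    then have N: "N \<lhd> G" and NK: "N \<subset> K" by (auto simp: \<N>_def)
    interpret N: normal N G by (rule N)
    interpret H: group "G Mod N" by (rule N.factorgroup_is_group)
    interpret \<pi>: group_hom G "G Mod N" "(#>) N"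
      by (intro group_hom.intro group_hom_axioms.intro N.r_coset_hom_Mod) unfold_locales
    have surj: "(#>) N ` carrier G = carrier (G Mod N)" by (simp add: carrier_FactGroup)
    interpret Q: minimal_normal "(#>) N ` K" "G Mod N"
    proof (rule minimal_normal_quotient[OF N K])
      show "N \<subseteq> K" using NK by blast
      show "L = N \<or> L = K" if "L \<lhd> G" "N \<subseteq> L" "L \<subseteq> K" for L
        using max that by (auto simp: \<N>_def)
    qed
    have central: "carrier (G Mod N) \<subseteq> centralizer (G Mod N) ((#>) N ` K)"
    proof (rule Q.central_if_generators)
      show "finite ((#>) N ` K)" using fin by simp
      show "(#>) N ` S \<subseteq> carrier (G Mod N)" using S surj by blast
      show "generate (G Mod N) ((#>) N ` S) = carrier (G Mod N)"
        by (simp only: \<pi>.generate_img[OF S] gen surj)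
      show "Gamma (G Mod N) (carrier (G Mod N)) c \<subseteq> (#>) N ` K"
        using \<pi>.Gamma_image[OF surj order_refl, of c, unfolded surj, symmetric] image_mono[OF nilp]
        by (rule ord_eq_le_trans)
    next
      fix g' v' assume "g' \<in> (#>) N ` S" "v' \<in> (#>) N ` K"
      then obtain g v where g: "g \<in> S" "g' = N #> g" and v: "v \<in> K" "v' = N #> v" by blast
      have G: "g \<in> carrier G" "v \<in> carrier G" using g v S by auto
      have "N #> (g \<otimes> (v \<otimes> g \<otimes> inv v)) = N #> ((v \<otimes> g \<otimes> inv v) \<otimes> g)"
        using comm[OF g(1) v(1)] by simp
      then show "g' \<otimes>\<^bsub>G Mod N\<^esub> (v' \<otimes>\<^bsub>G Mod N\<^esub> g' \<otimes>\<^bsub>G Mod N\<^esub> inv\<^bsub>G Mod N\<^esub> v')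
          = v' \<otimes>\<^bsub>G Mod N\<^esub> g' \<otimes>\<^bsub>G Mod N\<^esub> inv\<^bsub>G Mod N\<^esub> v' \<otimes>\<^bsub>G Mod N\<^esub> g'"
        using G g(2) v(2) by (simp del: mult_FactGroup)
    next
      fix h' g' assume "h' \<in> carrier (G Mod N)" "g' \<in> (#>) N ` S"
      then obtain h g where h: "h \<in> carrier G" "h' = N #> h" and g: "g \<in> S" "g' = N #> g"
        using surj by blast
      have "h' \<otimes>\<^bsub>G Mod N\<^esub> g' \<otimes>\<^bsub>G Mod N\<^esub> inv\<^bsub>G Mod N\<^esub> h' = N #> (h \<otimes> g \<otimes> inv h)"
        using h g S by (simp add: subset_iff del: mult_FactGroup)
      then show "h' \<otimes>\<^bsub>G Mod N\<^esub> g' \<otimes>\<^bsub>G Mod N\<^esub> inv\<^bsub>G Mod N\<^esub> h' \<in> (#>) N ` S"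
        using Sconj[OF h(1) g(1)] by blast
    qed
    have "x \<otimes> v \<otimes> inv x \<otimes> inv v \<in> N" if x: "x \<in> carrier G" and v: "v \<in> K" for x v
    proof -
      have vG: "v \<in> carrier G" using v by simp
      have "N #> x \<in> centralizer (G Mod N) ((#>) N ` K)" using central surj x by blast
      then have "(N #> x) \<otimes>\<^bsub>G Mod N\<^esub> (N #> v) = (N #> v) \<otimes>\<^bsub>G Mod N\<^esub> (N #> x)"
        using v unfolding centralizer_def by blast
      then have "(N #> x) \<otimes>\<^bsub>G Mod N\<^esub> (N #> v) \<otimes>\<^bsub>G Mod N\<^esub> inv\<^bsub>G Mod N\<^esub> (N #> x)
          \<otimes>\<^bsub>G Mod N\<^esub> inv\<^bsub>G Mod N\<^esub> (N #> v) = \<one>\<^bsub>G Mod N\<^esub>"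
        using H.commute_iff_commutator[of "N #> x" "N #> v"] x vG \<pi>.hom_closed by blast
      then have "N #> (x \<otimes> v \<otimes> inv x \<otimes> inv v) = \<one>\<^bsub>G Mod N\<^esub>"
        using x vG by (simp del: mult_FactGroup one_FactGroup)
      then show ?thesis
        using coset_join1[OF _ _ N.subgroup_axioms] x vG by simp
    qed
    then have KN: "Gamma G K 1 \<subseteq> N"
      by (simp add: commutator_subgroup_subset_iff[OF N.subgroup_axioms])
    \<comment> \<open>One further commutator with \<open>G\<close> moves the series from
      \<open>K\<close> into \<open>N\<close>.\<close>
    have "Gamma G (carrier G) (c + 1) \<subseteq> N"
      using Gamma_mono[OF nilp, of 1] KN by (simp add: Gamma_add)
    moreover have "card N < card K" using NK fin by (rule psubset_card_mono[rotated])
    moreover have "finite N" using NK fin finite_subset by blast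
    ultimately obtain d where d: "Gamma G N d = {\<one>}"
      using less.hyps[OF _ N _ comm] NK by blast
    have "Gamma G K (1 + d) \<subseteq> {\<one>}"
      unfolding Gamma_add using Gamma_mono[OF KN, of d] d by simp
    then have "Gamma G K (1 + d) = {\<one>}" using one_in_Gamma[OF K.one_closed] by blast
    then show ?thesis by blast
  qed
qed

section \<open>Inner automorphism groups\<close>

text \<open>\<open>Inn\<close> is defined by generation inside \<open>Aut Q\<close>, whereas the
  group-theoretic lemmas need generation inside \<open>Inn Q\<close> itself.\<close>

lemma (in quandle) generate_symm: "generate (Inn Q) (symm Q ` carrier Q) = carrier (Inn Q)"
proof -
  have "symm Q ` carrier Q \<subseteq> carrier (Inn Q)" using symm_in_Inn by blast
  then have "generate ((Aut Q)\<lparr>carrier := carrier (Inn Q)\<rparr>) (symm Q ` carrier Q)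
      = generate (Aut Q) (symm Q ` carrier Q)"
    using group.generate_consistent[OF group_Aut _ subgroup_Inn] by blast
  then show ?thesis by (simp add: Inn_def)
qed

lemma (in quandle) Inn_closed:
  assumes "g \<in> carrier (Inn Q)" "x \<in> carrier Q"
  shows "g x \<in> carrier Q"
  using Bij_imp_funcset[OF Inn_in_Bij[OF assms(1)]] assms(2) by blast

text \<open>Elements of \<open>Inn Q\<close> are quandle automorphisms, which gives g s_x = s_{g(x)}
  g. This translates operator-reducedness into commuting conjugates and makes the generating set
  conjugation-invariant.\<close>

lemma (in quandle) symm_conj:
  assumes g: "g \<in> carrier (Inn Q)" and x: "x \<in> carrier Q"
  shows "g \<otimes>\<^bsub>Inn Q\<^esub> symm Q x \<otimes>\<^bsub>Inn Q\<^esub> inv\<^bsub>Inn Q\<^esub> g = symm Q (g x)"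
proof -
  interpret I: group "Inn Q" by (rule group_Inn)
  have gx: "g x \<in> carrier Q" using g x by (rule Inn_closed)
  have hom: "g (act Q x y) = act Q (g x) (g y)" if "y \<in> carrier Q" for y
    using subgroup.subset[OF subgroup_Inn] g x that by (auto simp: Aut_def quandle_hom_def)
  have "compose (carrier Q) g (symm Q x) = compose (carrier Q) (symm Q (g x)) g"
    by (rule ext) (simp add: compose_def symm_def hom Inn_closed[OF g])
  then have "g \<otimes>\<^bsub>Inn Q\<^esub> symm Q x = symm Q (g x) \<otimes>\<^bsub>Inn Q\<^esub> g"
    using g x gx by (simp add: Inn_mult symm_in_Inn)
  then show ?thesis using g x gx by (simp add: symm_in_Inn I.m_assoc)
qed

lemma induced_epi:
  assumes "quandle P" "quandle Q" "f \<in> quandle_epi P Q"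
  shows "induced P Q f \<in> epi (Inn P) (Inn Q)"
  using theI'[OF induced_unique[OF assms]] unfolding induced_def by blast

theorem theorem0p6:
  fixes P :: "('a, 'm) quandle_scheme" and Q :: "('b, 'n) quandle_scheme" and f :: "'a \<Rightarrow> 'b"
  assumes "quandle P" and "quandle Q"
    and "operator_reduced P Q f"
    and "finite (Inn_rel P Q f)"
    and "nilpotent_quandle Q"
  shows "nilpotent_hom P Q f \<and> nilpotent_quandle P"
proof -
  interpret P: quandle P by fact
  interpret Q: quandle Q by fact
  interpret G: group "Inn P" by (rule P.group_Inn)
  interpret H: group "Inn Q" by (rule Q.group_Inn)
  have epi: "f \<in> quandle_epi P Q"
    and red: "\<And>x \<phi>. \<lbrakk>x \<in> carrier P; \<phi> \<in> Inn_rel P Q f\<rbrakk> \<Longrightarrow>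
      symm P x \<otimes>\<^bsub>Inn P\<^esub> symm P (\<phi> x) = symm P (\<phi> x) \<otimes>\<^bsub>Inn P\<^esub> symm P x"
    using assms(3) by (auto simp: operator_reduced_def)
  have h: "induced P Q f \<in> epi (Inn P) (Inn Q)"
    by (rule induced_epi[OF assms(1,2) epi])
  then have surj: "induced P Q f ` carrier (Inn P) = carrier (Inn Q)" by (simp add: epi_def)
  interpret h: group_hom "Inn P" "Inn Q" "induced P Q f"
    using h by unfold_locales (simp add: epi_def)
  let ?K = "Inn_rel P Q f" and ?G = "carrier (Inn P)"
  have K: "?K \<lhd> Inn P" unfolding Inn_rel_def by (rule h.normal_kernel)
  have KG: "?K \<subseteq> ?G" by (auto simp: Inn_rel_def kernel_def)
  obtain c where "Gamma (Inn Q) (carrier (Inn Q)) c = {\<one>\<^bsub>Inn Q\<^esub>}"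
    using assms(5) by (auto simp: nilpotent_quandle_def nilpotent_group_def)
  \<comment> \<open>Nilpotency of \<open>Q\<close> is pulled back: the \<open>c\<close>-th term of
    the lower central series of \<open>Inn P\<close> maps to the trivial group, so it lies in the
    kernel.\<close>
  then have "induced P Q f ` Gamma (Inn P) ?G c = {\<one>\<^bsub>Inn Q\<^esub>}"
    using h.Gamma_image[OF surj subset_refl, of c] surj by simp
  then have c: "Gamma (Inn P) ?G c \<subseteq> ?K"
    using G.Gamma_closed[OF subset_refl, of c] by (auto simp: Inn_rel_def kernel_def)
  have "\<exists>d. Gamma (Inn P) ?K d = {\<one>\<^bsub>Inn P\<^esub>}"
  proof (rule G.Gamma_eventually_trivial[OF K assms(4) _ P.generate_symm _ _ c])
    show "symm P ` carrier P \<subseteq> ?G" using P.symm_in_Inn by blast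
  next
    fix g v assume "g \<in> symm P ` carrier P" and v: "v \<in> ?K"
    then obtain x where x: "x \<in> carrier P" "g = symm P x" by blast
    \<comment> \<open>Here v g v^-1 is s_{v(x)}, which commutes with s_x by
      operator-reducedness.\<close>
    then show "g \<otimes>\<^bsub>Inn P\<^esub> (v \<otimes>\<^bsub>Inn P\<^esub> g \<otimes>\<^bsub>Inn P\<^esub> inv\<^bsub>Inn P\<^esub> v)
        = v \<otimes>\<^bsub>Inn P\<^esub> g \<otimes>\<^bsub>Inn P\<^esub> inv\<^bsub>Inn P\<^esub> v \<otimes>\<^bsub>Inn P\<^esub> g"
      using red[OF x(1) v] P.symm_conj[of v x] v KG by auto
  next
    fix h g assume h: "h \<in> ?G" and "g \<in> symm P ` carrier P"
    then show "h \<otimes>\<^bsub>Inn P\<^esub> g \<otimes>\<^bsub>Inn P\<^esub> inv\<^bsub>Inn P\<^esub> h \<in> symm P ` carrier P"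
      using P.symm_conj[OF h] P.Inn_closed[OF h] by auto
  qed
  then obtain d where d: "Gamma (Inn P) ?K d = {\<one>\<^bsub>Inn P\<^esub>}" by blast
  \<comment> \<open>After \<open>c\<close> steps the lower central series is inside
    \<open>?K\<close>, and \<open>d\<close> further steps make it trivial.\<close>
  have "Gamma (Inn P) ?G (c + d) \<subseteq> {\<one>\<^bsub>Inn P\<^esub>}"
    unfolding Gamma_add using G.Gamma_mono[OF c, of d] d by simp
  then have "Gamma (Inn P) ?G (c + d) = {\<one>\<^bsub>Inn P\<^esub>}"
    using G.one_in_Gamma[OF G.one_closed] by blast
  then have "nilpotent_quandle P"
    unfolding nilpotent_quandle_def nilpotent_group_def using G.is_group by blast
  then show ?thesis using epi d unfolding nilpotent_hom_def by blast
qed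

end
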